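(* For every $n\geq 2$, $\pi_1(S^n)\simeq 1$ (the trivial group).
   Context: Computational paths setting: paths are explicit rewrite sequences; $\sim$ is rewrite equality (equivalence closure of the $\mathrm{LND}_{\mathrm{EQ}}$-TRS, containing the groupoid laws); $\pi_1(A,a)=\mathrm{Path}(a,a)/{\sim}$. The pushout $\mathrm{Pushout}(A,B,C,f,g)$ has constructors $\mathrm{inl}$, $\mathrm{inr}$ and $\mathrm{glue}(c):\mathrm{Path}(\mathrm{inl}(f(c)),\mathrm{inr}(g(c)))$. The suspension is $\Sigma A:=\mathrm{Pushout}(\mathbf{1},\mathbf{1},A,\lambda\_.*,\lambda\_.* )$ with north $=\mathrm{inl}( * )$, south $=\mathrm{inr}( * )$, meridians $\mathrm{merid}(a)=\mathrm{glue}(a)$. The circle $S^1$ is the HIT with point $\mathrm{base}$ and loop $\mathrm{loop}:\mathrm{Path}(\mathrm{base},\mathrm{base})$, and $S^n$ is the $(n-1)$-fold iterated suspension $\Sigma^{n-1}(S^1)$; $\pi_1$ is taken at the north pole. *)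

theory Defs
  imports "HOL-Algebra.Elementary_Groups"
begin

text \<open>
  Points and elementary rewrite steps are raw codes in one universe shared by all types, so that
  a type former can be iterated inside the logic; which codes belong to a type is decided
  by the record \<open>ctype\<close> below.
\<close>

datatype point = Star | Base | PInl point | PInr point

datatype step = Loop | StepInl step | StepInr step | Glue point

text \<open>\<open>Refl\<close>, \<open>Sym\<close>, \<open>Trans\<close> are the operators \<open>\<rho>\<close>, \<open>\<sigma>\<close>, \<open>\<tau>\<close> on computational paths.\<close>

datatype cpath = Refl point | Step step | Sym cpath | Trans cpath cpath

text \<open>
  A type is presented by its canonical points, its elementary steps with their end points, and
  the rewrite rules between paths that are specific to it (in addition to the general ones).
\<close>

record ctype =
  points :: "point set"
  steps :: "(point \<times> step \<times> point) set"
  rules :: "(cpath \<times> cpath) set"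

inductive is_path :: "ctype \<Rightarrow> point \<Rightarrow> point \<Rightarrow> cpath \<Rightarrow> bool" for A where
  refl: "x \<in> points A \<Longrightarrow> is_path A x x (Refl x)"
| step: "(x, s, y) \<in> steps A \<Longrightarrow> x \<in> points A \<Longrightarrow> y \<in> points A \<Longrightarrow> is_path A x y (Step s)"
| sym: "is_path A x y p \<Longrightarrow> is_path A y x (Sym p)"
| trans: "is_path A x y p \<Longrightarrow> is_path A y z q \<Longrightarrow> is_path A x z (Trans p q)"

definition paths :: "ctype \<Rightarrow> point \<Rightarrow> point \<Rightarrow> cpath set" where
  "paths A x y = {p. is_path A x y p}"

text \<open>
  One-step rewriting of paths from \<open>x\<close> to \<open>y\<close>: the LND-EQ rules for \<open>\<rho>\<close>, \<open>\<sigma>\<close>, \<open>\<tau>\<close> under their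
  usual names, the rules of the type itself, and closure under \<open>\<sigma>\<close> and \<open>\<tau>\<close>. The remaining
  LND-EQ rules govern the proof terms of products, sums, function types and substitution and
  have no redexes among the paths considered here.
\<close>

inductive rw :: "ctype \<Rightarrow> point \<Rightarrow> point \<Rightarrow> cpath \<Rightarrow> cpath \<Rightarrow> bool" for A where
  sr: "x \<in> points A \<Longrightarrow> rw A x x (Sym (Refl x)) (Refl x)"
| ss: "is_path A x y p \<Longrightarrow> rw A x y (Sym (Sym p)) p"
| tr: "is_path A x y p \<Longrightarrow> rw A x x (Trans p (Sym p)) (Refl x)"
| tsr: "is_path A x y p \<Longrightarrow> rw A y y (Trans (Sym p) p) (Refl y)"
| rrr: "is_path A x y p \<Longrightarrow> rw A x y (Trans p (Refl y)) p"
| lrr: "is_path A x y p \<Longrightarrow> rw A x y (Trans (Refl x) p) p"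
| stss: "is_path A x y p \<Longrightarrow> is_path A y z q \<Longrightarrow>
    rw A z x (Sym (Trans p q)) (Trans (Sym q) (Sym p))"
| tt: "is_path A x y p \<Longrightarrow> is_path A y z q \<Longrightarrow> is_path A z w r \<Longrightarrow>
    rw A x w (Trans (Trans p q) r) (Trans p (Trans q r))"
| tts: "is_path A x y p \<Longrightarrow> is_path A x z q \<Longrightarrow> rw A x z (Trans p (Trans (Sym p) q)) q"
| tst: "is_path A x y p \<Longrightarrow> is_path A y z q \<Longrightarrow> rw A y z (Trans (Sym p) (Trans p q)) q"
| rule: "(p, q) \<in> rules A \<Longrightarrow> is_path A x y p \<Longrightarrow> is_path A x y q \<Longrightarrow> rw A x y p q"
| cong_sym: "rw A x y p q \<Longrightarrow> rw A y x (Sym p) (Sym q)"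
| cong_left: "rw A x y p q \<Longrightarrow> is_path A y z r \<Longrightarrow> rw A x z (Trans p r) (Trans q r)"
| cong_right: "is_path A x y r \<Longrightarrow> rw A y z p q \<Longrightarrow> rw A x z (Trans r p) (Trans r q)"

definition rweq :: "ctype \<Rightarrow> point \<Rightarrow> point \<Rightarrow> (cpath \<times> cpath) set" where
  "rweq A x y = {(p, q). p \<in> paths A x y \<and> q \<in> paths A x y \<and> equivclp (rw A x y) p q}"

definition pi1 :: "ctype \<Rightarrow> point \<Rightarrow> cpath set monoid" where
  "pi1 A a =
    \<lparr>carrier = paths A a a // rweq A a a,
     monoid.mult = (\<lambda>X Y. \<Union>p\<in>X. \<Union>q\<in>Y. rweq A a a `` {Trans p q}),
     one = rweq A a a `` {Refl a}\<rparr>"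

text \<open>
  A function between types acts on points and on paths; by functoriality the latter action
  is determined by its values on elementary steps.
\<close>

record cfun =
  on_point :: "point \<Rightarrow> point"
  on_step :: "step \<Rightarrow> cpath"

primrec ap :: "cfun \<Rightarrow> cpath \<Rightarrow> cpath" where
  "ap f (Refl x) = Refl (on_point f x)"
| "ap f (Step s) = on_step f s"
| "ap f (Sym p) = Sym (ap f p)"
| "ap f (Trans p q) = Trans (ap f p) (ap f q)"

definition const_fun :: "point \<Rightarrow> cfun" where
  "const_fun x = \<lparr>on_point = (\<lambda>_. x), on_step = (\<lambda>_. Refl x)\<rparr>"

definition inl :: cfun where
  "inl = \<lparr>on_point = PInl, on_step = (\<lambda>s. Step (StepInl s))\<rparr>"

definition inr :: cfun where
  "inr = \<lparr>on_point = PInr, on_step = (\<lambda>s. Step (StepInr s))\<rparr>"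

text \<open>
  The last set of rules is the action of the dependent constructor \<open>glue\<close> on the paths of \<open>C\<close>,
  that is, naturality of \<open>glue\<close>.
\<close>

definition pushout :: "ctype \<Rightarrow> ctype \<Rightarrow> ctype \<Rightarrow> cfun \<Rightarrow> cfun \<Rightarrow> ctype" where
  "pushout A B C f g =
    \<lparr>points = on_point inl ` points A \<union> on_point inr ` points B,
     steps = {(on_point inl x, StepInl s, on_point inl y) | x s y. (x, s, y) \<in> steps A}
       \<union> {(on_point inr x, StepInr s, on_point inr y) | x s y. (x, s, y) \<in> steps B}
       \<union> {(on_point inl (on_point f c), Glue c, on_point inr (on_point g c)) | c. c \<in> points C},
     rules = {(ap inl p, ap inl q) | p q. (p, q) \<in> rules A}
       \<union> {(ap inr p, ap inr q) | p q. (p, q) \<in> rules B}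
       \<union> {(Trans (ap inl (ap f p)) (Step (Glue c')), Trans (Step (Glue c)) (ap inr (ap g p)))
            | c c' p. p \<in> paths C c c'}\<rparr>"

definition unit_type :: ctype where
  "unit_type = \<lparr>points = {Star}, steps = {}, rules = {}\<rparr>"

definition circle :: ctype where
  "circle = \<lparr>points = {Base}, steps = {(Base, Loop, Base)}, rules = {}\<rparr>"

definition susp :: "ctype \<Rightarrow> ctype" where
  "susp A = pushout unit_type unit_type A (const_fun Star) (const_fun Star)"

definition north :: point where
  "north = on_point inl Star"

definition south :: point where
  "south = on_point inr Star"

text \<open>Meaningful for \<open>n \<ge> 1\<close> only.\<close>

definition sphere :: "nat \<Rightarrow> ctype" where
  "sphere n = (susp ^^ (n - 1)) circle"

lemma is_path_points: "is_path A x y p \<Longrightarrow> x \<in> points A \<and> y \<in> points A"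
  by (induction rule: is_path.induct) auto

lemma rw_is_path: "rw A x y p q \<Longrightarrow> is_path A x y p \<and> is_path A x y q"
  by (induction rule: rw.induct) (meson is_path.intros is_path_points)+

lemma equiv_rweq: "equiv (paths A x y) (rweq A x y)"
proof (rule equivI)
  show "rweq A x y \<subseteq> paths A x y \<times> paths A x y"
    by (auto simp: rweq_def)
  show "refl_on (paths A x y) (rweq A x y)"
    by (auto simp: refl_on_def rweq_def equivclp_def)
  show "sym_on UNIV (rweq A x y)"
    by (auto simp: sym_on_def rweq_def intro: equivclp_sym)
  show "trans_on UNIV (rweq A x y)"
    by (auto simp: trans_on_def rweq_def intro: equivclp_trans)
qed

lemma rweq_rw: "rw A x y p q \<Longrightarrow> (p, q) \<in> rweq A x y"
  by (auto simp: rweq_def paths_def dest: rw_is_path)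

lemma equivclp_map:
  assumes "equivclp r p q" and "\<And>p q. r p q \<Longrightarrow> s (h p) (h q)"
  shows "equivclp s (h p) (h q)"
  using assms(1) unfolding equivclp_def
proof (induction rule: rtranclp_induct)
  case (step y z)
  then have "symclp s (h y) (h z)"
    using assms(2) by (auto simp: symclp_def)
  with step show ?case by simp
qed simp

lemma rweq_Trans:
  assumes "(p, p') \<in> rweq A x y" "(q, q') \<in> rweq A y z"
  shows "(Trans p q, Trans p' q') \<in> rweq A x z"
proof -
  have ps: "is_path A x y p" "is_path A x y p'" "is_path A y z q" "is_path A y z q'"
    using assms by (auto simp: rweq_def paths_def)
  have "equivclp (rw A x z) (Trans p q) (Trans p' q)"
    using assms ps by (intro equivclp_map[where r = "rw A x y" and h = "\<lambda>p. Trans p q"])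
      (auto simp: rweq_def intro: rw.cong_left)
  moreover have "equivclp (rw A x z) (Trans p' q) (Trans p' q')"
    using assms ps by (intro equivclp_map[where r = "rw A y z" and h = "\<lambda>q. Trans p' q"])
      (auto simp: rweq_def intro: rw.cong_right)
  ultimately show ?thesis
    using ps by (auto simp: rweq_def paths_def intro: equivclp_trans is_path.trans)
qed

lemma mult_pi1_class:
  assumes "p \<in> paths A a a" "q \<in> paths A a a"
  shows "(rweq A a a `` {p}) \<otimes>\<^bsub>pi1 A a\<^esub> (rweq A a a `` {q}) = rweq A a a `` {Trans p q}"
proof -
  have "congruent2 (rweq A a a) (rweq A a a) (\<lambda>p q. rweq A a a `` {Trans p q})"
    by (auto simp: congruent2_def intro!: equiv_class_eq[OF equiv_rweq] rweq_Trans)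
  then show ?thesis
    using UN_equiv_class2[OF equiv_rweq equiv_rweq _ assms] by (simp add: pi1_def)
qed

lemma group_pi1:
  assumes a: "a \<in> points A"
  shows "group (pi1 A a)"
proof (rule groupI)
  let ?c = "\<lambda>p. rweq A a a `` {p}"
  have one: "\<one>\<^bsub>pi1 A a\<^esub> = ?c (Refl a)" by (simp add: pi1_def)
  have inC: "?c p \<in> carrier (pi1 A a)" if "is_path A a a p" for p
    using that by (auto simp: pi1_def paths_def intro: quotientI)
  have ex: "\<exists>p. is_path A a a p \<and> X = ?c p" if "X \<in> carrier (pi1 A a)" for X
    using that by (auto simp: pi1_def paths_def elim!: quotientE)
  have eq: "?c p = ?c q" if "rw A a a p q" for p q
    using equiv_class_eq[OF equiv_rweq rweq_rw[OF that]] .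
  have m: "?c p \<otimes>\<^bsub>pi1 A a\<^esub> ?c q = ?c (Trans p q)" if "is_path A a a p" "is_path A a a q" for p q
    using that by (simp add: mult_pi1_class paths_def)
  note intros = is_path.intros a
  show "\<one>\<^bsub>pi1 A a\<^esub> \<in> carrier (pi1 A a)"
    unfolding one by (intro inC intros)
  show "X \<otimes>\<^bsub>pi1 A a\<^esub> Y \<in> carrier (pi1 A a)"
    if "X \<in> carrier (pi1 A a)" "Y \<in> carrier (pi1 A a)" for X Y
    using ex[OF that(1)] ex[OF that(2)] by (auto simp: m intro!: inC is_path.trans)
  show "X \<otimes>\<^bsub>pi1 A a\<^esub> Y \<otimes>\<^bsub>pi1 A a\<^esub> Z = X \<otimes>\<^bsub>pi1 A a\<^esub> (Y \<otimes>\<^bsub>pi1 A a\<^esub> Z)"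
    if "X \<in> carrier (pi1 A a)" "Y \<in> carrier (pi1 A a)" "Z \<in> carrier (pi1 A a)" for X Y Z
    using ex[OF that(1)] ex[OF that(2)] ex[OF that(3)]
    by (elim exE conjE) (simp add: m is_path.trans eq[OF rw.tt])
  show "\<one>\<^bsub>pi1 A a\<^esub> \<otimes>\<^bsub>pi1 A a\<^esub> X = X" if "X \<in> carrier (pi1 A a)" for X
    using ex[OF that] by (elim exE conjE) (simp add: one m is_path.refl a eq[OF rw.lrr])
  show "\<exists>Y\<in>carrier (pi1 A a). Y \<otimes>\<^bsub>pi1 A a\<^esub> X = \<one>\<^bsub>pi1 A a\<^esub>" if X: "X \<in> carrier (pi1 A a)" for X
  proof -
    obtain p where p: "is_path A a a p" "X = ?c p" using ex[OF X] by blast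
    have "?c (Sym p) \<otimes>\<^bsub>pi1 A a\<^esub> X = \<one>\<^bsub>pi1 A a\<^esub>"
      unfolding p(2) one using p(1) by (simp add: m is_path.sym) (rule eq, erule rw.tsr)
    with p show ?thesis by (blast intro: inC is_path.sym)
  qed
qed

end

theory Submission
  imports Defs
begin

text \<open>
  In a suspension, naturality of \<open>glue\<close> along a path from \<open>c\<close> to \<open>c'\<close> says that the meridians of
  \<open>c\<close> and \<open>c'\<close> agree, since the constant map sends every path to one equal to \<open>Refl\<close>. If the
  suspended type is path connected, all meridians are therefore equal to a single one, which gives
  for every point \<open>x\<close> a path \<open>g x\<close> from the north pole such that \<open>Trans (g x) p \<sim> g y\<close> for every
  path \<open>p\<close> from \<open>x\<close> to \<open>y\<close>. Taking \<open>g north\<close> to be \<open>Refl north\<close> contracts all loops. Suspensions of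
  nonempty types are again path connected, which covers all spheres.
\<close>

lemma rweq_refl: "is_path A x y p \<Longrightarrow> (p, p) \<in> rweq A x y"
  by (auto simp: rweq_def paths_def)

lemma rweq_sym: "(p, q) \<in> rweq A x y \<Longrightarrow> (q, p) \<in> rweq A x y"
  by (auto simp: rweq_def intro: equivclp_sym)

lemma rweq_trans [trans]:
  "(p, q) \<in> rweq A x y \<Longrightarrow> (q, r) \<in> rweq A x y \<Longrightarrow> (p, r) \<in> rweq A x y"
  by (auto simp: rweq_def intro: equivclp_trans)

lemma rweq_is_path:
  assumes "(p, q) \<in> rweq A x y"
  shows "is_path A x y p" and "is_path A x y q"
  using assms by (auto simp: rweq_def paths_def)

lemma rweq_Sym:
  assumes "(p, q) \<in> rweq A x y"
  shows "(Sym p, Sym q) \<in> rweq A y x"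
proof -
  have "equivclp (rw A y x) (Sym p) (Sym q)"
    using assms by (intro equivclp_map[where r = "rw A x y" and h = Sym])
      (auto simp: rweq_def intro: rw.cong_sym)
  then show ?thesis
    using rweq_is_path[OF assms] by (simp add: rweq_def paths_def is_path.sym)
qed

text \<open>\<open>ap\<close> keeps the shape of \<open>p\<close>, so the image is a tree of
  \<open>Sym\<close> and \<open>Trans\<close> whose leaves are all \<open>Refl\<close>, and not a
  single \<open>Refl\<close>. The rules \<open>sr\<close> and \<open>lrr\<close> collapse it from
  the leaves upwards.\<close>

lemma rweq_ap_const_fun:
  assumes "on_point h z \<in> points A"
  shows "(ap h (ap (const_fun z) p), Refl (on_point h z)) \<in> rweq A (on_point h z) (on_point h z)"
proof (induction p)
  case (Sym p)
  show ?case
    using rweq_trans[OF rweq_Sym[OF Sym] rweq_rw[OF rw.sr[OF assms]]] by simp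
next
  case (Trans p q)
  show ?case
    using rweq_trans[OF rweq_Trans[OF Trans] rweq_rw[OF rw.lrr[OF is_path.refl[OF assms]]]]
    by simp
qed (auto simp: const_fun_def intro: rweq_refl is_path.refl assms)

text \<open>Compatibility of \<open>g\<close> with elementary steps extends to all paths, because
  these are built from steps by the groupoid operations. Only meridians then have to be checked by
  hand.\<close>

lemma rweq_path_family:
  assumes g: "\<And>x. x \<in> points A \<Longrightarrow> is_path A a x (g x)"
    and step: "\<And>x s y. (x, s, y) \<in> steps A \<Longrightarrow> x \<in> points A \<Longrightarrow> y \<in> points A \<Longrightarrow>
      (Trans (g x) (Step s), g y) \<in> rweq A a y"
    and p: "is_path A x y p"
  shows "(Trans (g x) p, g y) \<in> rweq A a y"
  using p
proof (induction rule: is_path.induct)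
  case (refl x)
  then show ?case by (intro rweq_rw rw.rrr g)
next
  case (step x s y)
  then show ?case by (rule assms(2))
next
  case (sym x y p)
  then have gx: "is_path A a x (g x)"
    by (auto intro: g dest: is_path_points)
  \<comment> \<open>The induction hypothesis is read backwards: \<open>g y\<close> expands to
    \<open>Trans (g x) p\<close>, so that \<open>p\<close> cancels against
    \<open>Sym p\<close>.\<close>
  have "(Trans (g y) (Sym p), Trans (Trans (g x) p) (Sym p)) \<in> rweq A a x"
    by (rule rweq_Trans[OF rweq_sym[OF sym.IH] rweq_refl[OF is_path.sym[OF sym.hyps]]])
  also have "(Trans (Trans (g x) p) (Sym p), Trans (g x) (Trans p (Sym p))) \<in> rweq A a x"
    by (rule rweq_rw[OF rw.tt[OF gx sym.hyps is_path.sym[OF sym.hyps]]])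
  also have "(Trans (g x) (Trans p (Sym p)), Trans (g x) (Refl x)) \<in> rweq A a x"
    by (rule rweq_Trans[OF rweq_refl[OF gx] rweq_rw[OF rw.tr[OF sym.hyps]]])
  also have "(Trans (g x) (Refl x), g x) \<in> rweq A a x"
    using gx by (intro rweq_rw rw.rrr)
  finally show ?case .
next
  case (trans x y p z q)
  then have gx: "is_path A a x (g x)"
    by (auto intro: g dest: is_path_points)
  have "(Trans (g x) (Trans p q), Trans (Trans (g x) p) q) \<in> rweq A a z"
    by (rule rweq_sym[OF rweq_rw[OF rw.tt[OF gx trans.hyps]]])
  also have "(Trans (Trans (g x) p) q, Trans (g y) q) \<in> rweq A a z"
    by (rule rweq_Trans[OF trans.IH(1) rweq_refl[OF trans.hyps(2)]])
  also have "(Trans (g y) q, g z) \<in> rweq A a z"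
    by (rule trans.IH)
  finally show ?case .
qed

lemma trivial_group_pi1:
  assumes a: "a \<in> points A"
    and loops: "\<And>p. is_path A a a p \<Longrightarrow> (p, Refl a) \<in> rweq A a a"
  shows "trivial_group (pi1 A a)"
proof -
  have "rweq A a a `` {p} = rweq A a a `` {Refl a}" if "p \<in> paths A a a" for p
    using that by (intro equiv_class_eq[OF equiv_rweq] loops) (simp add: paths_def)
  then have "paths A a a // rweq A a a \<subseteq> {rweq A a a `` {Refl a}}"
    by (blast elim: quotientE)
  moreover have "rweq A a a `` {Refl a} \<in> paths A a a // rweq A a a"
    using a by (intro quotientI) (simp add: paths_def is_path.refl)
  ultimately have "carrier (pi1 A a) = {\<one>\<^bsub>pi1 A a\<^esub>}"
    unfolding pi1_def by auto
  then show ?thesis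
    using group_pi1[OF a] by (simp add: trivial_group_def)
qed

text \<open>Nonemptiness is included because it supplies a meridian: the suspension of the empty
  type has two points and no step between them.\<close>

definition path_connected_type :: "ctype \<Rightarrow> bool" where
  "path_connected_type A \<longleftrightarrow>
    points A \<noteq> {} \<and> (\<forall>x\<in>points A. \<forall>y\<in>points A. \<exists>p. is_path A x y p)"

lemma points_susp: "points (susp A) = {north, south}"
  by (auto simp: susp_def pushout_def unit_type_def north_def south_def)

lemma steps_susp: "steps (susp A) = {(north, Glue c, south) | c. c \<in> points A}"
  by (auto simp: susp_def pushout_def unit_type_def const_fun_def north_def south_def)

lemma is_path_Glue: "c \<in> points A \<Longrightarrow> is_path (susp A) north south (Step (Glue c))"
  by (rule is_path.step) (auto simp: points_susp steps_susp)

text \<open>The naturality square of \<open>glue\<close> along \<open>p\<close> has the two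
  meridians as opposite sides. Its other two sides \<open>?l\<close> and \<open>?r\<close> come from
  constant maps and collapse to \<open>Refl\<close>.\<close>

lemma rweq_susp_Glue:
  assumes p: "is_path A c c' p"
  shows "(Step (Glue c'), Step (Glue c)) \<in> rweq (susp A) north south"
proof -
  let ?l = "ap inl (ap (const_fun Star) p)" and ?r = "ap inr (ap (const_fun Star) p)"
  have glue: "is_path (susp A) north south (Step (Glue c))"
      "is_path (susp A) north south (Step (Glue c'))"
    using is_path_points[OF p] by (auto intro: is_path_Glue)
  have l: "(?l, Refl north) \<in> rweq (susp A) north north"
    using rweq_ap_const_fun[of inl Star] by (simp add: points_susp north_def)
  have r: "(?r, Refl south) \<in> rweq (susp A) south south"
    using rweq_ap_const_fun[of inr Star] by (simp add: points_susp south_def)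
  have "(Step (Glue c'), Trans (Refl north) (Step (Glue c'))) \<in> rweq (susp A) north south"
    using glue by (intro rweq_sym[OF rweq_rw] rw.lrr)
  also have "(Trans (Refl north) (Step (Glue c')),
      Trans ?l (Step (Glue c'))) \<in> rweq (susp A) north south"
    by (rule rweq_Trans[OF rweq_sym[OF l] rweq_refl[OF glue(2)]])
  also have "(Trans ?l (Step (Glue c')),
      Trans (Step (Glue c)) ?r) \<in> rweq (susp A) north south"
  proof (intro rweq_rw rw.rule)
    show "(Trans ?l (Step (Glue c')), Trans (Step (Glue c)) ?r) \<in> rules (susp A)"
      using p by (auto simp: susp_def pushout_def paths_def)
      show "is_path (susp A) north south (Trans ?l (Step (Glue c')))"
      by (rule is_path.trans[OF rweq_is_path(1)[OF l] glue(2)])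
    show "is_path (susp A) north south (Trans (Step (Glue c)) ?r)"
      by (rule is_path.trans[OF glue(1) rweq_is_path(1)[OF r]])
  qed
  also have "(Trans (Step (Glue c)) ?r,
      Trans (Step (Glue c)) (Refl south)) \<in> rweq (susp A) north south"
    by (rule rweq_Trans[OF rweq_refl[OF glue(1)] r])
  also have "(Trans (Step (Glue c)) (Refl south),
      Step (Glue c)) \<in> rweq (susp A) north south"
    using glue by (intro rweq_rw rw.rrr)
  finally show ?thesis .
qed

lemma path_connected_type_susp:
  assumes "points A \<noteq> {}"
  shows "path_connected_type (susp A)"
proof -
  obtain c where "c \<in> points A" using assms by blast
  then have glue: "is_path (susp A) north south (Step (Glue c))"
    by (rule is_path_Glue)
  moreover have "is_path (susp A) south north (Sym (Step (Glue c)))"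
    using glue by (rule is_path.sym)
  moreover have "is_path (susp A) x x (Refl x)" if "x \<in> points (susp A)" for x
    using that by (rule is_path.refl)
  ultimately show ?thesis
    unfolding path_connected_type_def points_susp by blast
qed

lemma trivial_group_pi1_susp:
  assumes A: "path_connected_type A"
  shows "trivial_group (pi1 (susp A) north)"
proof (rule trivial_group_pi1)
  show north: "north \<in> points (susp A)" by (simp add: points_susp)
  obtain c where c: "c \<in> points A" using A by (auto simp: path_connected_type_def)
  \<comment> \<open>The value at \<open>south\<close> is the meridian of the fixed point
    \<open>c\<close>; the value at \<open>north\<close> is \<open>Refl north\<close>, so that
    compatibility with a loop \<open>p\<close> says that \<open>p\<close> itself is trivial.\<close>
  define g where "g x = (if x = north then Refl north else Step (Glue c))" for x
  have ns: "south \<noteq> north" by (simp add: north_def south_def inl_def inr_def)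
  have g: "is_path (susp A) north x (g x)" if "x \<in> points (susp A)" for x
    using that north c by (auto simp: g_def points_susp ns intro: is_path.refl is_path_Glue)
  have step: "(Trans (g x) (Step s), g y) \<in> rweq (susp A) north y"
    if xsy: "(x, s, y) \<in> steps (susp A)" for x s y
  proof -
    obtain c' where c': "c' \<in> points A" "x = north" "y = south" "s = Glue c'"
      using xsy by (auto simp: steps_susp)
    \<comment> \<open>This is where connectedness enters: a path from \<open>c\<close> to
      \<open>c'\<close> identifies an arbitrary meridian with the chosen one.\<close>
    obtain p where "is_path A c c' p"
      using A c c' by (auto simp: path_connected_type_def)
    then have "(Step s, g y) \<in> rweq (susp A) north south"
      using c' ns by (auto simp: g_def intro: rweq_susp_Glue)
    moreover have "(Trans (g x) (Step s), Step s) \<in> rweq (susp A) north south"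
      using c' by (auto simp: g_def intro!: rweq_rw rw.lrr is_path_Glue)
    ultimately show ?thesis
      unfolding \<open>y = south\<close> by (rule rweq_trans[rotated])
  qed
  show "(p, Refl north) \<in> rweq (susp A) north north" if p: "is_path (susp A) north north p" for p
  proof -
    have "(Trans (Refl north) p, Refl north) \<in> rweq (susp A) north north"
      using rweq_path_family[of "susp A" north g, OF g step p] by (simp add: g_def)
    then show ?thesis
      by (rule rweq_trans[OF rweq_sym[OF rweq_rw[OF rw.lrr[OF p]]]])
  qed
qed

lemma path_connected_type_circle: "path_connected_type circle"
proof -
  have "is_path circle Base Base (Refl Base)"
    by (rule is_path.refl) (simp add: circle_def)
  then show ?thesis
    by (auto simp: path_connected_type_def circle_def)
qed

text \<open>The inductive step takes from the previous stage only that it has a point.\<close>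

lemma path_connected_type_iterated_susp:
  "path_connected_type A \<Longrightarrow> path_connected_type ((susp ^^ k) A)"
  by (induction k) (auto simp: path_connected_type_def[of "(susp ^^ _) A"]
      intro: path_connected_type_susp)

theorem mainTheorem5:
  fixes n :: nat
  assumes "n \<ge> 2"
  shows "pi1 (sphere n) north \<cong> singleton_group ()"
proof -
  \<comment> \<open>With \<open>n - 1 = Suc k\<close>, the sphere has an outermost suspension, taken
    over the connected type \<open>(susp ^^ k) circle\<close>.\<close>
  obtain k where "n = Suc (Suc k)"
    using assms by (metis add_2_eq_Suc le_Suc_ex)
  then have "trivial_group (pi1 (sphere n) north)"
    by (simp add: sphere_def trivial_group_pi1_susp path_connected_type_iterated_susp
        path_connected_type_circle)
  \<comment> \<open>The carrier consists of the unit class alone, so the constant map to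
    \<open>()\<close> is a bijection.\<close>
  then show ?thesis
    by (auto simp: trivial_group_def is_iso_def iso_def hom_def bij_betw_def singleton_group_def
        dest: group.is_monoid[THEN monoid.l_one] intro!: exI[of _ "\<lambda>_. ()"])
qed

end
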